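(* Let $0\le k\le n$, and let $w^{\odot}\in S_{n,k}^{\odot}$ have associated Bruhat interval $[u,v]$ and positroid $\mathcal{M}$. For any $y\in[u,v]$, the codimension of the tangent space to $\Pi_{[u,v]}\subseteq Gr(k,n)$ at $A_{y[k]}$ is \[\operatorname{rank}(Jac|_{A_{y[k]}})=\#\Big\{I\in\binom{[n]}{k}\setminus\mathcal{M}: |I\cap y[k]|=k-1\Big\}.\]
   Context: $[n]=\{1,\dots,n\}$ and $\binom{[n]}{k}$ is the set of $k$-subsets of $[n]$. $Gr(k,n)$ is the Grassmannian of $k$-dimensional subspaces of $\mathbb{C}^n$; a point is the row span of a full-rank $k\times n$ complex matrix, and for $I\in\binom{[n]}{k}$ the Plücker coordinate $\Delta_I$ is the $k\times k$ minor in the columns $I$. For $J=\{j_1<\dots<j_k\}$, $A_J\in Gr(k,n)$ is the row span of the $k\times n$ matrix with a $1$ in cell $(i,j_i)$ for each $i$ and $0$ elsewhere. For $y\in S_n$, $y[k]=\{y(1),\dots,y(k)\}$. A decorated permutation on $n$ elements is a permutation $w\in S_n$ together with a label "clockwise" or "counterclockwise" on each fixed point. An element $i$ is an anti-exceedance if $i<w^{-1}(i)$ or $i$ is a clockwise fixed point; $S_{n,k}^{\odot}$ is the set of decorated permutations on $n$ elements with exactly $k$ anti-exceedances. For $r\in[n]$ let $<_r$ be the order $r<_r r+1<_r\cdots<_r n<_r 1<_r\cdots<_r r-1$, and $I_r(w)=\{i: i<_r w^{-1}(i)\text{ or } i \text{ is a clockwise fixed point}\}$. For $I=\{i_1<_r\dots<_r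 i_k\}$, $J=\{j_1<_r\dots<_r j_k\}$, write $I\preceq_r J$ if $i_h\le_r j_h$ for all $h$. The positroid is $\mathcal{M}=\{I\in\binom{[n]}{k}: I_r(w)\preceq_r I\ \forall r\}$. The associated Bruhat interval $[u,v]$: $v$ is the unique permutation with $v(1)<\dots<v(k)$, $v(k+1)<\dots<v(n)$ and $\{v(1),\dots,v(k)\}=w^{-1}(I_1(w))$, and $u=wv$ ($u(i)=w(v(i))$); $[u,v]=\{y: u\le y\le v\}$ in Bruhat order ($x\le y$ iff for each $i$ the sorted $\{x(1),\dots,x(i)\}$ is componentwise $\le$ the sorted $\{y(1),\dots,y(i)\}$). The positroid variety $\Pi_{[u,v]}$ is the subvariety of $Gr(k,n)$ whose vanishing ideal is generated by $\{\Delta_I:I\notin\mathcal{M}\}$ (equivalently the projection $V_\bullet\mapsto V_k$ of the Richardson variety $X_u\cap X^v$ in the complete flag variety). $Jac$ denotes the Jacobian matrix of the defining polynomials $\{\Delta_I:I\notin\mathcal{M}\}$ (in local coordinates on $Gr(k,n)$), so that $\operatorname{rank}(Jac|_x)$ is the codimension in $Gr(k,n)$ of the tangent space to $\Pi_{[u,v]}$ at $x$. *)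

theory Defs
  imports "HOL-Analysis.Derivative" "Jordan_Normal_Form.DL_Rank"
begin

unbundle no vec_syntax
hide_const (open) Finite_Cartesian_Product.mat Finite_Cartesian_Product.vec

section \<open>Decorated permutations, positroids and Bruhat intervals\<close>

text \<open>Throughout, \<open>[n]\<close> is \<^term>\<open>{1..n}\<close>, and column \<open>j\<close> of a matrix is column \<open>j - 1\<close> of
  the (0-based) matrix type.\<close>

definition ksubsets :: "nat \<Rightarrow> nat \<Rightarrow> nat set set" where
  "ksubsets n k = {I. I \<subseteq> {1..n} \<and> card I = k}"

text \<open>A decorated permutation is a pair \<open>(w, cw)\<close>, where \<open>cw\<close> is the set of those fixed points
  of \<open>w\<close> in \<open>[n]\<close> that are labelled clockwise; all other fixed points are counterclockwise.\<close>

definition decorated_perm :: "nat \<Rightarrow> (nat \<Rightarrow> nat) \<times> nat set \<Rightarrow> bool" where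
  "decorated_perm n = (\<lambda>(w, cw). w permutes {1..n} \<and> cw \<subseteq> {i \<in> {1..n}. w i = i})"

definition anti_exceedances :: "nat \<Rightarrow> (nat \<Rightarrow> nat) \<times> nat set \<Rightarrow> nat set" where
  "anti_exceedances n = (\<lambda>(w, cw). {i \<in> {1..n}. i < inv_into UNIV w i \<or> i \<in> cw})"

definition decorated_perms :: "nat \<Rightarrow> nat \<Rightarrow> ((nat \<Rightarrow> nat) \<times> nat set) set" where
  "decorated_perms n k = {d. decorated_perm n d \<and> card (anti_exceedances n d) = k}"

text \<open>The position of \<open>i\<close>, counted from 0, in the list \<open>r, r + 1, \<dots>, n, 1, \<dots>, r - 1\<close>.\<close>

definition cyc_pos :: "nat \<Rightarrow> nat \<Rightarrow> nat \<Rightarrow> nat" where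
  "cyc_pos n r i = (if r \<le> i then i - r else i + n - r)"

definition cyc_less :: "nat \<Rightarrow> nat \<Rightarrow> nat \<Rightarrow> nat \<Rightarrow> bool" where
  "cyc_less n r i j \<longleftrightarrow> cyc_pos n r i < cyc_pos n r j"

definition cyc_le :: "nat \<Rightarrow> nat \<Rightarrow> nat \<Rightarrow> nat \<Rightarrow> bool" where
  "cyc_le n r i j \<longleftrightarrow> cyc_pos n r i \<le> cyc_pos n r j"

definition cyc_sorted_list :: "nat \<Rightarrow> nat \<Rightarrow> nat set \<Rightarrow> nat list" where
  "cyc_sorted_list n r I = sort_key (cyc_pos n r) (sorted_list_of_set I)"

definition gale_le :: "nat \<Rightarrow> nat \<Rightarrow> nat set \<Rightarrow> nat set \<Rightarrow> bool" where
  "gale_le n r I J \<longleftrightarrow> list_all2 (cyc_le n r) (cyc_sorted_list n r I) (cyc_sorted_list n r J)"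

definition necklace :: "nat \<Rightarrow> (nat \<Rightarrow> nat) \<times> nat set \<Rightarrow> nat \<Rightarrow> nat set" where
  "necklace n = (\<lambda>(w, cw) r. {i \<in> {1..n}. cyc_less n r i (inv_into UNIV w i) \<or> i \<in> cw})"

definition positroid :: "nat \<Rightarrow> nat \<Rightarrow> (nat \<Rightarrow> nat) \<times> nat set \<Rightarrow> nat set set" where
  "positroid n k d = {I \<in> ksubsets n k. \<forall>r\<in>{1..n}. gale_le n r (necklace n d r) I}"

definition bruhat_le :: "nat \<Rightarrow> (nat \<Rightarrow> nat) \<Rightarrow> (nat \<Rightarrow> nat) \<Rightarrow> bool" where
  "bruhat_le n x y \<longleftrightarrow>
     (\<forall>i\<in>{1..n}. list_all2 (\<le>) (sorted_list_of_set (x ` {1..i})) (sorted_list_of_set (y ` {1..i})))"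

definition bruhat_interval :: "nat \<Rightarrow> (nat \<Rightarrow> nat) \<Rightarrow> (nat \<Rightarrow> nat) \<Rightarrow> (nat \<Rightarrow> nat) set" where
  "bruhat_interval n u v = {y. y permutes {1..n} \<and> bruhat_le n u y \<and> bruhat_le n y v}"

text \<open>The conditions on \<open>u\<close> and \<open>v\<close> determine both permutations uniquely.\<close>

definition associated_pair ::
  "nat \<Rightarrow> nat \<Rightarrow> (nat \<Rightarrow> nat) \<times> nat set \<Rightarrow> (nat \<Rightarrow> nat) \<Rightarrow> (nat \<Rightarrow> nat) \<Rightarrow> bool" where
  "associated_pair n k d u v \<longleftrightarrow>
     v permutes {1..n} \<and> strict_mono_on {1..k} v \<and> strict_mono_on {k+1..n} v \<and>
     v ` {1..k} = inv_into UNIV (fst d) ` necklace n d 1 \<and> u = fst d \<circ> v"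


section \<open>Local coordinates on the Grassmannian\<close>

definition plucker :: "nat \<Rightarrow> complex mat \<Rightarrow> nat set \<Rightarrow> complex" where
  "plucker k A I = det (mat k k (\<lambda>(a, b). A $$ (a, sorted_list_of_set I ! b - 1)))"

text \<open>A point of \<open>Gr(k,n)\<close> is the row space of a full-rank \<open>k \<times> n\<close> matrix; this is \<open>A\<^sub>J\<close>.\<close>

definition coordinate_point :: "nat \<Rightarrow> nat \<Rightarrow> nat set \<Rightarrow> complex vec set" where
  "coordinate_point k n J =
     vec_space.row_space n (mat k n (\<lambda>(a, b). if sorted_list_of_set J ! a = b + 1 then 1 else 0))"

text \<open>The affine chart of \<open>Gr(k,n)\<close> on the open set where the Pluecker coordinate of \<open>B\<close> does not
  vanish: a subspace in it is the row space of exactly one matrix whose columns in \<open>B\<close> form the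
  identity matrix. The local coordinates are the remaining entries \<open>x (i, j)\<close> with
  \<open>i \<in> [k]\<close> and \<open>j \<in> [n] - B\<close>; other values of \<open>x\<close> are irrelevant.\<close>

type_synonym coords = "nat \<times> nat \<Rightarrow> complex"

definition chart_mat :: "nat \<Rightarrow> nat \<Rightarrow> nat set \<Rightarrow> coords \<Rightarrow> complex mat" where
  "chart_mat k n B x = mat k n (\<lambda>(a, b).
     if b + 1 \<in> B then (if sorted_list_of_set B ! a = b + 1 then 1 else 0) else x (a + 1, b + 1))"

definition chart :: "nat \<Rightarrow> nat \<Rightarrow> nat set \<Rightarrow> coords \<Rightarrow> complex vec set" where
  "chart k n B x = vec_space.row_space n (chart_mat k n B x)"

lemma chart_zero:
  assumes "J \<in> ksubsets n k"
  shows "chart k n J (\<lambda>_. 0) = coordinate_point k n J"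
proof -
  have fin: "finite J" and len: "length (sorted_list_of_set J) = k"
    using assms by (auto simp: ksubsets_def intro: finite_subset)
  have mem: "sorted_list_of_set J ! a \<in> J" if "a < k" for a
    using nth_mem[of a "sorted_list_of_set J"] that len fin by simp
  have "chart_mat k n J (\<lambda>_. 0) =
      mat k n (\<lambda>(a, b). if sorted_list_of_set J ! a = b + 1 then 1 else 0)"
    using mem by (intro eq_matI) (auto simp: chart_mat_def, metis)
  then show ?thesis
    by (simp add: chart_def coordinate_point_def)
qed

definition coord_list :: "nat \<Rightarrow> nat \<Rightarrow> nat set \<Rightarrow> (nat \<times> nat) list" where
  "coord_list k n B = List.product [1..<k+1] (filter (\<lambda>j. j \<notin> B) [1..<n+1])"

text \<open>In the chart of \<open>B\<close> the Pluecker coordinate of \<open>B\<close> is 1, so this is the regular function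
  \<open>\<Delta>\<^sub>I / \<Delta>\<^sub>B\<close> in local coordinates.\<close>

definition local_plucker :: "nat \<Rightarrow> nat \<Rightarrow> nat set \<Rightarrow> nat set \<Rightarrow> coords \<Rightarrow> complex" where
  "local_plucker k n B I x = plucker k (chart_mat k n B x) I"

inductive_set poly_functions :: "(nat \<times> nat) set \<Rightarrow> (coords \<Rightarrow> complex) set"
  for C :: "(nat \<times> nat) set" where
  const: "(\<lambda>x. c) \<in> poly_functions C"
| coord: "p \<in> C \<Longrightarrow> (\<lambda>x. x p) \<in> poly_functions C"
| add: "f \<in> poly_functions C \<Longrightarrow> g \<in> poly_functions C \<Longrightarrow> (\<lambda>x. f x + g x) \<in> poly_functions C"
| mult: "f \<in> poly_functions C \<Longrightarrow> g \<in> poly_functions C \<Longrightarrow> (\<lambda>x. f x * g x) \<in> poly_functions C"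

definition partial_deriv :: "(coords \<Rightarrow> complex) \<Rightarrow> nat \<times> nat \<Rightarrow> coords \<Rightarrow> complex" where
  "partial_deriv f p x = deriv (\<lambda>t. f (x(p := t))) (x p)"


section \<open>Positroid varieties: ideal, tangent space and Jacobian matrix\<close>

text \<open>The ideal of the positroid variety of \<open>M\<close> in the coordinate ring of the chart of \<open>B\<close>,
  generated by the Pluecker coordinates outside \<open>M\<close>.\<close>

definition positroid_ideal ::
  "nat \<Rightarrow> nat \<Rightarrow> nat set set \<Rightarrow> nat set \<Rightarrow> (coords \<Rightarrow> complex) set" where
  "positroid_ideal k n M B =
     {\<lambda>x. \<Sum>I\<in>ksubsets n k - M. g I x * local_plucker k n B I x | g.
        \<forall>I\<in>ksubsets n k - M. g I \<in> poly_functions (set (coord_list k n B))}"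

text \<open>The Zariski tangent space of the positroid variety at the point with local coordinates \<open>x\<close>,
  as a subspace of the tangent space of \<open>Gr(k,n)\<close>; tangent vectors are written with respect to
  the coordinates in the order of \<^const>\<open>coord_list\<close>.\<close>

definition tangent_space ::
  "nat \<Rightarrow> nat \<Rightarrow> nat set set \<Rightarrow> nat set \<Rightarrow> coords \<Rightarrow> complex vec set" where
  "tangent_space k n M B x =
     {t \<in> carrier_vec (length (coord_list k n B)). \<forall>f\<in>positroid_ideal k n M B.
        (\<Sum>j<length (coord_list k n B). partial_deriv f (coord_list k n B ! j) x * t $ j) = 0}"

definition tangent_codim :: "nat \<Rightarrow> nat \<Rightarrow> nat set set \<Rightarrow> nat set \<Rightarrow> coords \<Rightarrow> nat" where
  "tangent_codim k n M B x =
     k * (n - k) - vectorspace.dim class_ring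
       ((module_vec TYPE(complex) (length (coord_list k n B)))
          \<lparr>carrier := tangent_space k n M B x\<rparr>)"

definition nonbasis_list :: "nat \<Rightarrow> nat \<Rightarrow> nat set set \<Rightarrow> nat set list" where
  "nonbasis_list k n M = filter (\<lambda>I. I \<in> ksubsets n k - M) (map set (subseqs [1..<n+1]))"

text \<open>Rows are indexed by the \<open>k\<close>-subsets outside \<open>M\<close>, columns by the local coordinates.\<close>

definition jacobian :: "nat \<Rightarrow> nat \<Rightarrow> nat set set \<Rightarrow> nat set \<Rightarrow> coords \<Rightarrow> complex mat" where
  "jacobian k n M B x =
     mat (length (nonbasis_list k n M)) (length (coord_list k n B))
       (\<lambda>(i, j). partial_deriv (local_plucker k n B (nonbasis_list k n M ! i))
                   (coord_list k n B ! j) x)"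

definition mat_rank :: "complex mat \<Rightarrow> nat" where
  "mat_rank A = vec_space.rank (dim_row A) A"

end

theory Submission
  imports Defs
begin

text \<open>In the chart of \<open>B\<close> the point \<open>A\<^sub>B\<close> has all coordinates zero, and along a coordinate line
  through it the Pluecker coordinate of \<open>I \<noteq> B\<close> vanishes unless \<open>I\<close> arises from \<open>B\<close> by the one
  exchange that belongs to this coordinate, when it is plus or minus the coordinate itself. So the
  Jacobian has at most one nonzero entry in every row and column, and its rank counts the exchanges
  that leave \<open>M\<close>. If moreover \<open>B \<in> M\<close>, all generators of the ideal vanish at the point, and the
  tangent space is the coordinate subspace of the exchanges that stay in \<open>M\<close>.

  It remains to see that \<open>y[k] \<in> M\<close>, that is, \<open>y[k]\<close> meets no cyclic interval starting at \<open>r\<close> in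
  more points than the necklace set \<open>I\<^sub>r\<close>. Since \<open>v\<close> increases on both blocks, the positions in one
  block with \<open>v\<close>-value below \<open>r\<close> form an initial segment, which ends at some \<open>m\<close>. Comparing
  \<open>u[m]\<close>, \<open>y[m]\<close> and \<open>v[m]\<close> gives the bound, with the second block for intervals \<open>[r,s]\<close>, and with
  the first block and complements for intervals that wrap around.\<close>

section \<open>Bruhat intervals and positroids\<close>

lemma card_filter_sorted_list_of_set:
  "finite S \<Longrightarrow> length (filter P (sorted_list_of_set S)) = card {x \<in> S. P x}"
  by (simp add: distinct_length_filter Int_def conj_commute)

lemma list_all2_le_length_filter:
  fixes t :: "'a :: order"
  assumes "list_all2 (\<le>) xs ys"
  shows "length (filter (\<lambda>x. x \<le> t) ys) \<le> length (filter (\<lambda>x. x \<le> t) xs)"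
  using assms by (induction rule: list_all2_induct) auto

text \<open>In a componentwise comparison the larger list has fewer entries below any threshold.
  Injectivity turns this count of values into a count of positions, which can then be split along
  the two blocks of \<open>v\<close>.\<close>

lemma bruhat_le_card:
  assumes "bruhat_le n x y" "inj x" "inj y" "m \<le> n"
  shows "card {a \<in> {1..m}. y a \<le> t} \<le> card {a \<in> {1..m}. x a \<le> t}"
proof (cases "m = 0")
  case False
  have img: "card {b \<in> z ` {1..m}. b \<le> t} = card {a \<in> {1..m}. z a \<le> t}"
    if "inj z" for z :: "nat \<Rightarrow> nat"
  proof -
    have "{b \<in> z ` {1..m}. b \<le> t} = z ` {a \<in> {1..m}. z a \<le> t}" by auto
    then show ?thesis using that by (simp add: card_image inj_on_def)
  qed
  have "list_all2 (\<le>) (sorted_list_of_set (x ` {1..m})) (sorted_list_of_set (y ` {1..m}))"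
    using assms(1,4) False by (simp add: bruhat_le_def)
  from list_all2_le_length_filter[OF this, of t] show ?thesis
    unfolding card_filter_sorted_list_of_set[OF finite_imageI[OF finite_atLeastAtMost]]
      img[OF assms(2)] img[OF assms(3)] .
qed simp

text \<open>If entry \<open>h\<close> of \<open>I\<close> came strictly after entry \<open>h\<close>
  of \<open>J\<close>, the threshold at the latter would admit at least \<open>h + 1\<close>
  elements of \<open>J\<close> but at most \<open>h\<close> of \<open>I\<close>.\<close>

lemma gale_leI:
  assumes fin: "finite I" "finite J" and card: "card I = card J"
    and count: "\<And>t. card {j \<in> J. cyc_pos n r j \<le> t} \<le> card {i \<in> I. cyc_pos n r i \<le> t}"
  shows "gale_le n r I J"
proof -
  let ?f = "cyc_pos n r" and ?s = "cyc_sorted_list n r"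
  have props: "set (?s S) = S" "distinct (?s S)" "length (?s S) = card S" "sorted (map ?f (?s S))"
    if "finite S" for S
    using that by (simp_all add: cyc_sorted_list_def)
  have "?f (?s I ! h) \<le> ?f (?s J ! h)" if h: "h < card I" for h
  proof (rule ccontr)
    assume "\<not> ?thesis"
    then have lt: "?f (?s J ! h) < ?f (?s I ! h)" by simp
    let ?t = "?f (?s J ! h)"
    have mono: "?f (?s S ! p) \<le> ?f (?s S ! q)" if "finite S" "p \<le> q" "q < card S" for S p q
      using sorted_nth_mono[OF props(4)[OF that(1)], of p q] that props(3)[OF that(1)] by simp
    have "(!) (?s J) ` {..h} \<subseteq> {j \<in> J. ?f j \<le> ?t}"
    proof (intro image_subsetI)
      fix p assume "p \<in> {..h}"
      then show "?s J ! p \<in> {j \<in> J. ?f j \<le> ?t}"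
        using mono[OF fin(2), of p h] nth_mem[of p "?s J"] props[OF fin(2)] h card by auto
    qed
    then have "card ((!) (?s J) ` {..h}) \<le> card {j \<in> J. ?f j \<le> ?t}"
      using fin by (intro card_mono) auto
    moreover have "card ((!) (?s J) ` {..h}) = Suc h"
      using props[OF fin(2)] h card by (subst card_image) (auto simp: inj_on_def nth_eq_iff_index_eq)
    moreover have "{i \<in> I. ?f i \<le> ?t} \<subseteq> (!) (?s I) ` {..<h}"
    proof
      fix i assume i: "i \<in> {i \<in> I. ?f i \<le> ?t}"
      then obtain p where p: "p < card I" "i = ?s I ! p"
        using props[OF fin(1)] by (metis (no_types, lifting) in_set_conv_nth mem_Collect_eq)
      have "p < h"
        using mono[OF fin(1), of h p] p i lt by force
      then show "i \<in> (!) (?s I) ` {..<h}" using p by auto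
    qed
    then have "card {i \<in> I. ?f i \<le> ?t} \<le> card ((!) (?s I) ` {..<h})"
      by (intro card_mono) auto
    moreover have "card ((!) (?s I) ` {..<h}) \<le> h"
      using card_image_le[of "{..<h}" "(!) (?s I)"] by simp
    ultimately show False using count[of ?t] by simp
  qed
  then show ?thesis
    unfolding gale_le_def list_all2_conv_all_nth cyc_le_def using props fin card by simp
qed

text \<open>A downward closed condition is encoded by the last position where it holds, with
  \<open>m = k\<close> if there is none. It serves for \<open>v a < r\<close> on each block where
  \<open>v\<close> increases.\<close>

lemma threshold_exists:
  fixes k n :: nat
  assumes "k \<le> n" and "\<And>a b. k < a \<Longrightarrow> a \<le> b \<Longrightarrow> b \<le> n \<Longrightarrow> P b \<Longrightarrow> P a"
  shows "\<exists>m. k \<le> m \<and> m \<le> n \<and> (\<forall>a\<in>{k+1..n}. P a \<longleftrightarrow> a \<le> m)"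
  using assms
proof (induction n rule: dec_induct)
  case base
  then show ?case by auto
next
  case (step n)
  show ?case
  proof (cases "P (Suc n)")
    case True
    then have "\<forall>a\<in>{k+1..Suc n}. P a \<longleftrightarrow> a \<le> Suc n"
      using step.prems by auto
    then show ?thesis using step.hyps by (intro exI[of _ "Suc n"]) auto
  next
    case False
    have "\<exists>m. k \<le> m \<and> m \<le> n \<and> (\<forall>a\<in>{k+1..n}. P a \<longleftrightarrow> a \<le> m)"
      by (rule step.IH) (use step.prems in \<open>meson le_SucI\<close>)
    then obtain m where m: "k \<le> m" "m \<le> n" "\<forall>a\<in>{k+1..n}. P a \<longleftrightarrow> a \<le> m" by blast
    then have "\<forall>a\<in>{k+1..Suc n}. P a \<longleftrightarrow> a \<le> m"
      using False by (auto simp: le_Suc_eq)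
    then show ?thesis using m by (intro exI[of _ m]) auto
  qed
qed

section \<open>Necklace positions and values in cyclic intervals\<close>

lemma card_permutes_less:
  assumes "p permutes {1..n}" "1 \<le> r" "r \<le> n"
  shows "card {a \<in> {1..n}. p a < r} = r - 1"
proof -
  have "p ` {a \<in> {1..n}. p a < r} = {1..<r}"
  proof
    show "p ` {a \<in> {1..n}. p a < r} \<subseteq> {1..<r}"
      using permutes_in_image[OF assms(1)] by fastforce
    show "{1..<r} \<subseteq> p ` {a \<in> {1..n}. p a < r}"
    proof
      fix b assume b: "b \<in> {1..<r}"
      then have "b \<in> p ` {1..n}" using permutes_image[OF assms(1)] assms by auto
      then show "b \<in> p ` {a \<in> {1..n}. p a < r}" using b by auto
    qed
  qed
  moreover have "card (p ` {a \<in> {1..n}. p a < r}) = card {a \<in> {1..n}. p a < r}"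
    using permutes_inj[OF assms(1)] by (intro card_image) (simp add: inj_on_def)
  ultimately show ?thesis by simp
qed

text \<open>The two weak inequalities are all that is kept of the decorated permutation. Equality in
  the first block comes from clockwise fixed points, in the second from counterclockwise
  ones.\<close>

locale richardson_pair =
  fixes n k :: nat and u v :: "nat \<Rightarrow> nat"
  assumes k_le_n: "k \<le> n"
    and u_perm: "u permutes {1..n}" and v_perm: "v permutes {1..n}"
    and v_mono1: "strict_mono_on {1..k} v" and v_mono2: "strict_mono_on {k+1..n} v"
    and u_le_v: "\<And>a. a \<in> {1..k} \<Longrightarrow> u a \<le> v a"
    and v_le_u: "\<And>a. a \<in> {k+1..n} \<Longrightarrow> v a \<le> u a"
begin

text \<open>The positions at which \<open>u\<close> takes the values in the \<open>r\<close>-th set of the necklace.\<close>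

definition neck_index :: "nat \<Rightarrow> nat set" where
  "neck_index r = {a \<in> {1..k}. \<not> (u a < r \<and> r \<le> v a)} \<union> {a \<in> {k+1..n}. v a < r \<and> r \<le> u a}"

lemma neck_index_subset: "neck_index r \<subseteq> {1..n}"
  using k_le_n by (auto simp: neck_index_def)

lemma finite_neck_index [simp]: "finite (neck_index r)"
  using neck_index_subset finite_subset by blast

text \<open>Both \<open>u\<close> and \<open>v\<close> take exactly \<open>r - 1\<close> values
  below \<open>r\<close>. The positions where only \<open>u\<close> is below \<open>r\<close> form
  \<open>?C1\<close>, those where only \<open>v\<close> is below form \<open>?C2\<close>, so these
  sets are equally large. Replacing \<open>?C1\<close> by \<open>?C2\<close> in
  \<open>{1..k}\<close> gives \<open>neck_index r\<close>.\<close>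

lemma card_neck_index:
  assumes "r \<in> {1..n}"
  shows "card (neck_index r) = k"
proof -
  let ?C1 = "{a \<in> {1..k}. u a < r \<and> r \<le> v a}" and ?C2 = "{a \<in> {k+1..n}. v a < r \<and> r \<le> u a}"
  let ?U = "{a \<in> {1..n}. u a < r}" and ?V = "{a \<in> {1..n}. v a < r}"
  have union: "?U \<union> ?C2 = ?V \<union> ?C1"
  proof (rule Set.set_eqI)
    fix a
    show "a \<in> ?U \<union> ?C2 \<longleftrightarrow> a \<in> ?V \<union> ?C1"
      using u_le_v[of a] v_le_u[of a] k_le_n by (cases "a \<le> k") auto
  qed
  have "card ?U + card ?C2 = card (?U \<union> ?C2)"
    by (rule card_Un_disjoint[symmetric]) auto
  also have "\<dots> = card ?V + card ?C1"
    unfolding union by (rule card_Un_disjoint) auto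
  finally have eq: "card ?C2 = card ?C1"
    using card_permutes_less[OF u_perm, of r] card_permutes_less[OF v_perm, of r] assms by auto
  have "card (neck_index r) = card {a \<in> {1..k}. \<not> (u a < r \<and> r \<le> v a)} + card ?C2"
    unfolding neck_index_def by (rule card_Un_disjoint) auto
  also have "\<dots> = card ({a \<in> {1..k}. \<not> (u a < r \<and> r \<le> v a)} \<union> ?C1)"
    unfolding eq by (rule card_Un_disjoint[symmetric]) auto
  also have "{a \<in> {1..k}. \<not> (u a < r \<and> r \<le> v a)} \<union> ?C1 = {1..k}" by auto
  finally show ?thesis by simp
qed

context
  fixes y :: "nat \<Rightarrow> nat" and r :: nat
  assumes y_perm: "y permutes {1..n}" and u_le_y: "bruhat_le n u y" and y_le_v: "bruhat_le n y v"
    and r: "r \<in> {1..n}"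
begin

text \<open>Let \<open>m\<close> be the last position in the second block with
  \<open>v\<close>-value below \<open>r\<close>, or \<open>k\<close>. Among the first
  \<open>m\<close> positions \<open>y\<close> has at most as many values up to \<open>s\<close> as
  \<open>u\<close>, and at least as many below \<open>r\<close>; subtracting compares the values in
  \<open>[r,s]\<close>. Every position up to \<open>m\<close> where \<open>u\<close> is at least
  \<open>r\<close> lies in \<open>neck_index r\<close>.\<close>

lemma card_interval_le:
  assumes "r \<le> s"
  shows "card {a \<in> {1..k}. r \<le> y a \<and> y a \<le> s} \<le> card {a \<in> neck_index r. r \<le> u a \<and> u a \<le> s}"
proof -
  have "\<exists>m. k \<le> m \<and> m \<le> n \<and> (\<forall>a\<in>{k+1..n}. v a < r \<longleftrightarrow> a \<le> m)"
  proof (rule threshold_exists[OF k_le_n])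
    fix a b assume "k < a" "a \<le> b" "b \<le> n" "v b < r"
    then show "v a < r"
      using strict_mono_onD[OF v_mono2, of a b] by (cases "a = b") auto
  qed
  then obtain m where m: "k \<le> m" "m \<le> n" "\<And>a. a \<in> {k+1..n} \<Longrightarrow> v a < r \<longleftrightarrow> a \<le> m"
    by blast
  have split: "card {a \<in> {1..m}. z a \<le> s} =
      card {a \<in> {1..m}. r \<le> z a \<and> z a \<le> s} + card {a \<in> {1..m}. z a < r}" for z :: "nat \<Rightarrow> nat"
  proof -
    have "{a \<in> {1..m}. z a \<le> s} = {a \<in> {1..m}. r \<le> z a \<and> z a \<le> s} \<union> {a \<in> {1..m}. z a < r}"
      using assms by auto
    then show ?thesis by (simp add: card_Un_disjoint disjoint_iff)
  qed
  have less: "{a \<in> {1..m}. z a < r} = {a \<in> {1..m}. z a \<le> r - 1}" for z :: "nat \<Rightarrow> nat"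
    using r by auto
  \<comment> \<open>All values below \<open>r\<close> are taken by \<open>v\<close>, hence also by \<open>y\<close>, on the first \<open>m\<close> positions.\<close>
  have "{a \<in> {1..m}. v a < r} = {a \<in> {1..n}. v a < r}"
    using m by auto (metis Suc_leI le_trans not_le)
  then have "r - 1 = card {a \<in> {1..m}. v a < r}"
    using card_permutes_less[OF v_perm] r by simp
  also have "\<dots> \<le> card {a \<in> {1..m}. y a < r}"
    unfolding less using y_le_v y_perm v_perm m(2)
    by (intro bruhat_le_card) (auto intro: permutes_inj)
  finally have "r - 1 \<le> card {a \<in> {1..m}. y a < r}" .
  moreover have "card {a \<in> {1..m}. u a < r} \<le> r - 1"
  proof -
    have "card {a \<in> {1..m}. u a < r} \<le> card {a \<in> {1..n}. u a < r}"
      using m by (intro card_mono) auto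
    then show ?thesis using card_permutes_less[OF u_perm] r by simp
  qed
  moreover have "card {a \<in> {1..m}. y a \<le> s} \<le> card {a \<in> {1..m}. u a \<le> s}"
    using u_le_y y_perm u_perm m(2) by (intro bruhat_le_card) (auto intro: permutes_inj)
  ultimately have "card {a \<in> {1..m}. r \<le> y a \<and> y a \<le> s} \<le> card {a \<in> {1..m}. r \<le> u a \<and> u a \<le> s}"
    using split[of y] split[of u] by linarith
  moreover have "card {a \<in> {1..k}. r \<le> y a \<and> y a \<le> s} \<le> card {a \<in> {1..m}. r \<le> y a \<and> y a \<le> s}"
    using m by (intro card_mono) auto
  moreover have "card {a \<in> {1..m}. r \<le> u a \<and> u a \<le> s} \<le> card {a \<in> neck_index r. r \<le> u a \<and> u a \<le> s}"
    using m by (intro card_mono) (auto simp: neck_index_def)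
  ultimately show ?thesis by linarith
qed

text \<open>This is the complementary bound, hence reversed, for intervals that wrap around. A
  necklace position with \<open>u a < r\<close> lies in the first block and has
  \<open>v a < r\<close>, so it is at most \<open>m\<close>. There \<open>v\<close>, and by Bruhat
  comparison also \<open>y\<close>, stays below \<open>r\<close>, and \<open>y\<close> exceeds
  \<open>s\<close> at least as often as \<open>u\<close>.\<close>

lemma card_open_interval_le:
  "card {a \<in> neck_index r. s < u a \<and> u a < r} \<le> card {a \<in> {1..k}. s < y a \<and> y a < r}"
proof -
  have "\<exists>m. 0 \<le> m \<and> m \<le> k \<and> (\<forall>a\<in>{0+1..k}. v a < r \<longleftrightarrow> a \<le> m)"
  proof (rule threshold_exists)
    fix a b assume "0 < a" "a \<le> b" "b \<le> k" "v b < r"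
    then show "v a < r"
      using strict_mono_onD[OF v_mono1, of a b] by (cases "a = b") auto
  qed simp
  then obtain m where m: "m \<le> k" "\<And>a. a \<in> {1..k} \<Longrightarrow> v a < r \<longleftrightarrow> a \<le> m"
    by auto
  have mn: "m \<le> n" using m k_le_n by simp
  have split: "m = card {a \<in> {1..m}. s < z a} + card {a \<in> {1..m}. z a \<le> s}" for z :: "nat \<Rightarrow> nat"
  proof -
    have "card {a \<in> {1..m}. s < z a} + card {a \<in> {1..m}. z a \<le> s} =
        card ({a \<in> {1..m}. s < z a} \<union> {a \<in> {1..m}. z a \<le> s})"
      by (rule card_Un_disjoint[symmetric]) auto
    also have "{a \<in> {1..m}. s < z a} \<union> {a \<in> {1..m}. z a \<le> s} = {1..m}" by auto
    finally show ?thesis by simp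
  qed
  have "card {a \<in> {1..m}. v a \<le> r - 1} \<le> card {a \<in> {1..m}. y a \<le> r - 1}"
    using y_le_v y_perm v_perm mn by (intro bruhat_le_card) (auto intro: permutes_inj)
  moreover have v_eq: "{a \<in> {1..m}. v a \<le> r - 1} = {1..m}"
  proof -
    have "v a \<le> r - 1" if "a \<in> {1..m}" for a
      using m(2)[of a] that m(1) by auto
    then show ?thesis by blast
  qed
  ultimately have "card {1..m} \<le> card {a \<in> {1..m}. y a \<le> r - 1}" by simp
  then have y_eq: "{a \<in> {1..m}. y a \<le> r - 1} = {1..m}"
    by (rule card_seteq[rotated 2]) auto
  have y_less: "y a < r" if "a \<in> {1..m}" for a
  proof -
    have "y a \<le> r - 1" using that y_eq by blast
    then show ?thesis using r by auto
  qed
  have "{a \<in> neck_index r. s < u a \<and> u a < r} \<subseteq> {a \<in> {1..m}. s < u a}"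
    using m by (auto simp: neck_index_def not_le)
  then have "card {a \<in> neck_index r. s < u a \<and> u a < r} \<le> card {a \<in> {1..m}. s < u a}"
    by (intro card_mono) auto
  moreover have "card {a \<in> {1..m}. y a \<le> s} \<le> card {a \<in> {1..m}. u a \<le> s}"
    using u_le_y y_perm u_perm mn by (intro bruhat_le_card) (auto intro: permutes_inj)
  moreover have "card {a \<in> {1..m}. s < y a} \<le> card {a \<in> {1..k}. s < y a \<and> y a < r}"
    using m y_less by (intro card_mono) auto
  ultimately show ?thesis using split[of u] split[of y] by linarith
qed

lemma gale_le_interval: "gale_le n r (u ` neck_index r) (y ` {1..k})"
proof (rule gale_leI)
  have card_im: "card (p ` S) = card S" if "p permutes {1..n}" for p :: "nat \<Rightarrow> nat" and S
    using permutes_inj[OF that] by (intro card_image) (simp add: inj_on_def)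
  show "card (u ` neck_index r) = card (y ` {1..k})"
    using card_im[OF u_perm] card_im[OF y_perm] card_neck_index[OF r] by simp
  fix t
  have restr: "card {j \<in> p ` S. P j} = card {a \<in> S. P (p a)}"
    if "p permutes {1..n}" for p :: "nat \<Rightarrow> nat" and S P
  proof -
    have "{j \<in> p ` S. P j} = p ` {a \<in> S. P (p a)}" by auto
    then show ?thesis by (simp add: card_im[OF that])
  qed
  have range: "p a \<in> {1..n}" if "p permutes {1..n}" "a \<in> {1..n}" for p :: "nat \<Rightarrow> nat" and a
    using that(2) permutes_in_image[OF that(1)] by simp
  have y_range: "y a \<in> {1..n}" if "a \<in> {1..k}" for a
    using range[OF y_perm, of a] that k_le_n by simp
  have u_range: "u a \<in> {1..n}" if "a \<in> neck_index r" for a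
    using range[OF u_perm, of a] that neck_index_subset by blast
  have "card {a \<in> {1..k}. cyc_pos n r (y a) \<le> t} \<le> card {a \<in> neck_index r. cyc_pos n r (u a) \<le> t}"
  \<comment> \<open>The first \<open>t + 1\<close> elements of the cyclic order form the plain
    interval from \<open>r\<close> to \<open>r + t\<close> as long as this stays within
    \<open>n\<close>. Otherwise they are the complement of the open interval from
    \<open>r + t - n\<close> to \<open>r\<close>, and complements are counted.\<close>
  proof (cases "r + t \<le> n")
    case True
    have pos: "cyc_pos n r j \<le> t \<longleftrightarrow> r \<le> j \<and> j \<le> r + t" if "j \<in> {1..n}" for j
      using that True r by (auto simp: cyc_pos_def)
    have "{a \<in> {1..k}. cyc_pos n r (y a) \<le> t} = {a \<in> {1..k}. r \<le> y a \<and> y a \<le> r + t}"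
      using pos y_range by blast
    moreover have "{a \<in> neck_index r. cyc_pos n r (u a) \<le> t} = {a \<in> neck_index r. r \<le> u a \<and> u a \<le> r + t}"
      using pos u_range by blast
    ultimately show ?thesis using card_interval_le[of "r + t"] by simp
  next
    case False
    define s where "s = r + t - n"
    have pos: "cyc_pos n r j \<le> t \<longleftrightarrow> \<not> (s < j \<and> j < r)" if "j \<in> {1..n}" for j
      using that False r by (auto simp: cyc_pos_def s_def)
    have split: "card {a \<in> S. cyc_pos n r (p a) \<le> t} + card {a \<in> S. s < p a \<and> p a < r} = card S"
      if "finite S" "\<And>a. a \<in> S \<Longrightarrow> p a \<in> {1..n}" for S and p :: "nat \<Rightarrow> nat"
    proof -
      have "S = {a \<in> S. cyc_pos n r (p a) \<le> t} \<union> {a \<in> S. s < p a \<and> p a < r}"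
        using pos that(2) by blast
      moreover have "{a \<in> S. cyc_pos n r (p a) \<le> t} \<inter> {a \<in> S. s < p a \<and> p a < r} = {}"
        using pos that(2) by blast
      ultimately show ?thesis
        using card_Un_disjoint[of "{a \<in> S. cyc_pos n r (p a) \<le> t}" "{a \<in> S. s < p a \<and> p a < r}"] that(1)
        by simp
    qed
    have "card {a \<in> neck_index r. cyc_pos n r (u a) \<le> t} +
        card {a \<in> neck_index r. s < u a \<and> u a < r} = card (neck_index r)"
      by (rule split) (use u_range in auto)
    moreover have "card {a \<in> {1..k}. cyc_pos n r (y a) \<le> t} +
        card {a \<in> {1..k}. s < y a \<and> y a < r} = card {1..k}"
      by (rule split) (use y_range in auto)
    ultimately show ?thesis
      using card_open_interval_le[of s] card_neck_index[OF r] by simp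
  qed
  then show "card {j \<in> y ` {1..k}. cyc_pos n r j \<le> t} \<le> card {i \<in> u ` neck_index r. cyc_pos n r i \<le> t}"
    by (simp add: restr[OF u_perm] restr[OF y_perm])
qed auto

end
end

section \<open>From decorated permutations to the two inequalities\<close>

text \<open>The inverse of \<open>w\<close> sends \<open>u a\<close> to \<open>v a\<close>, so
  \<open>a \<le> k\<close> means that \<open>u a\<close> belongs to the first necklace set, that is,
  \<open>u a < v a\<close> or \<open>u a\<close> is clockwise. Clockwise labels sit on fixed points,
  where \<open>u a = v a\<close>.\<close>

lemma associated_pair_values:
  assumes w: "w permutes {1..n}" and cw: "cw \<subseteq> {i \<in> {1..n}. w i = i}"
    and uv: "associated_pair n k (w, cw) u v" and a: "a \<in> {1..n}"
  shows "if a \<le> k then u a < v a \<and> u a \<notin> cw \<or> u a = v a \<and> u a \<in> cw else v a \<le> u a \<and> u a \<notin> cw"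
proof -
  have v: "v permutes {1..n}" and vk: "v ` {1..k} = inv_into UNIV w ` necklace n (w, cw) 1" and u: "u = w \<circ> v"
    using uv by (auto simp: associated_pair_def)
  have up: "u permutes {1..n}" using v w u by (simp add: permutes_compose)
  have inv: "inv_into UNIV w (u a) = v a" using permutes_inverses[OF w] u by simp
  have range: "u a \<in> {1..n}" "v a \<in> {1..n}"
    using a permutes_in_image[OF up] permutes_in_image[OF v] by auto
  have "u a \<in> necklace n (w, cw) 1 \<longleftrightarrow> v a \<in> v ` {1..k}"
    unfolding vk inv[symmetric] using permutes_inj[OF permutes_inv[OF w]]
    by (simp add: inj_image_mem_iff)
  also have "\<dots> \<longleftrightarrow> a \<le> k"
    using a permutes_inj[OF v] by (simp add: inj_image_mem_iff)
  finally have "a \<le> k \<longleftrightarrow> u a < v a \<or> u a \<in> cw"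
    using range by (simp add: necklace_def cyc_less_def cyc_pos_def inv)
      (metis diff_less_mono linorder_not_le diff_le_mono)
  moreover have "u a = v a" if "u a \<in> cw"
  proof -
    have "w (u a) = u a" using that cw by auto
    then have "inv_into UNIV w (u a) = u a" using permutes_inv_eq[OF w] by blast
    then show ?thesis using inv by simp
  qed
  ultimately show ?thesis by auto
qed

lemma bruhat_interval_positroid:
  assumes "k \<le> n" and d: "decorated_perm n d" and uv: "associated_pair n k d u v"
    and y: "y \<in> bruhat_interval n u v"
  shows "y ` {1..k} \<in> positroid n k d"
proof -
  obtain w cw where d_eq: "d = (w, cw)" by fastforce
  have w: "w permutes {1..n}" and cw: "cw \<subseteq> {i \<in> {1..n}. w i = i}"
    using d d_eq by (auto simp: decorated_perm_def)
  have v: "v permutes {1..n}" and u: "u = w \<circ> v"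
    and mono: "strict_mono_on {1..k} v" "strict_mono_on {k+1..n} v"
    using uv d_eq by (auto simp: associated_pair_def)
  have up: "u permutes {1..n}" using v w u by (simp add: permutes_compose)
  have yp: "y permutes {1..n}" "bruhat_le n u y" "bruhat_le n y v"
    using y by (auto simp: bruhat_interval_def)
  note vals = associated_pair_values[OF w cw uv[unfolded d_eq]]
  interpret richardson_pair n k u v
  proof
    show "u a \<le> v a" if "a \<in> {1..k}" for a
      using vals[of a] that \<open>k \<le> n\<close> by auto
    show "v a \<le> u a" if "a \<in> {k+1..n}" for a
      using vals[of a] that by auto
  qed (use assms up v mono in auto)
  have "necklace n d r = u ` neck_index r" if r: "r \<in> {1..n}" for r
  proof -
    \<comment> \<open>The cyclic order agrees with the usual order on \<open>u a\<close> and
      \<open>v a\<close> unless \<open>r\<close> separates them. For \<open>u a < v a\<close> this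
      excludes \<open>u a < r \<le> v a\<close>; for \<open>v a \<le> u a\<close> it leaves exactly
      \<open>v a < r \<le> u a\<close>. Clockwise fixed points are in the first part for every
      \<open>r\<close>.\<close>
    have "u a \<in> necklace n d r \<longleftrightarrow> a \<in> neck_index r" if a: "a \<in> {1..n}" for a
    proof -
      have inv: "inv_into UNIV w (u a) = v a" using permutes_inverses[OF w] u by simp
      have range: "u a \<in> {1..n}" "v a \<in> {1..n}"
        using a permutes_in_image[OF up] permutes_in_image[OF v] by auto
      show ?thesis
        using vals[OF a] range a r
        by (auto simp: d_eq necklace_def neck_index_def inv cyc_less_def cyc_pos_def split: if_splits)
    qed
    moreover have "necklace n d r \<subseteq> u ` {1..n}"
      using permutes_image[OF up] by (auto simp: d_eq necklace_def)
    ultimately show ?thesis using neck_index_subset by blast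
  qed
  moreover have "y ` {1..k} \<in> ksubsets n k"
    using permutes_image[OF yp(1)] assms(1) permutes_inj[OF yp(1)]
    by (auto simp: ksubsets_def card_image inj_on_def permutes_in_image[OF yp(1)])
  ultimately show ?thesis
    using gale_le_interval[OF yp] by (simp add: positroid_def)
qed


section \<open>Coordinate subspaces and monomial matrices\<close>

context vec_space
begin

lemma zero_coords_submodule:
  "submodule class_ring {v \<in> carrier_vec n. \<forall>i<n. i \<notin> R \<longrightarrow> v $ i = 0} V"
  by unfold_locales auto

lemma span_unit_vecs_subset:
  assumes "R \<subseteq> {..<n}"
  shows "span (unit_vec n ` R) = {v \<in> carrier_vec n. \<forall>i<n. i \<notin> R \<longrightarrow> v $ i = 0}"
    (is "_ = ?W")
proof
  show "span (unit_vec n ` R) \<subseteq> ?W"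
    using assms by (intro span_is_subset[OF _ zero_coords_submodule]) auto
next
  have fin: "finite R" using assms finite_subset by blast
  have inj: "inj_on (unit_vec n :: nat \<Rightarrow> 'a vec) R"
    using assms by (auto simp: inj_on_def)
  have U: "unit_vec n ` R \<subseteq> (carrier_vec n :: 'a vec set)" by auto
  show "?W \<subseteq> span (unit_vec n ` R)"
  proof
    fix v assume v: "v \<in> ?W"
    \<comment> \<open>Coefficients of \<open>lincomb\<close> are indexed by vectors, so the index of
      a unit vector has to be recovered before the entry of \<open>v\<close> is read.\<close>
    define a :: "'a vec \<Rightarrow> 'a" where "a = (\<lambda>u. v $ (inv_into R (unit_vec n) u))"
    have "v = lincomb a (unit_vec n ` R)"
    proof (rule eq_vecI)
      show "dim_vec v = dim_vec (lincomb a (unit_vec n ` R))"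
        using v fin U by (simp add: lincomb_dim)
      fix i assume "i < dim_vec (lincomb a (unit_vec n ` R))"
      then have i: "i < n" using fin U by (simp add: lincomb_dim)
      have "lincomb a (unit_vec n ` R) $ i = (\<Sum>j\<in>R. v $ j * unit_vec n j $ i)"
        unfolding lincomb_index[OF i U] sum.reindex[OF inj]
        by (rule sum.cong) (simp_all add: a_def inj)
      also have "\<dots> = (\<Sum>j\<in>R. if j = i then v $ i else 0)"
        using assms i by (intro sum.cong) auto
      also have "\<dots> = v $ i" using v fin i by simp
      finally show "v $ i = lincomb a (unit_vec n ` R) $ i" by simp
    qed
    then show "v \<in> span (unit_vec n ` R)"
      using fin U by (auto simp: finite_span)
  qed
qed

lemma dim_zero_coords:
  assumes "R \<subseteq> {..<n}"
  shows "vectorspace.dim class_ring (vs {v \<in> carrier_vec n. \<forall>i<n. i \<notin> R \<longrightarrow> v $ i = 0}) = card R"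
proof -
  let ?U = "unit_vec n ` R :: 'a vec set"
  have fin: "finite R" using assms finite_subset by blast
  have "?U \<subseteq> set (unit_vecs n)" using assms by (auto simp: unit_vecs_def)
  then have "lin_indpt ?U"
    using unit_vecs_basis supset_ld_is_ld unfolding basis_def by blast
  then have "maximal ?U (\<lambda>T. T \<subseteq> ?U \<and> lin_indpt T)"
    by (auto simp: maximal_def)
  then have "vectorspace.dim class_ring (span_vs ?U) = card ?U"
    using fin by (intro dim_span) auto
  also have "card ?U = card R"
    using assms by (intro card_image) (auto simp: inj_on_def)
  finally show ?thesis
    unfolding span_unit_vecs_subset[OF assms] .
qed

text \<open>The columns and the unit vectors indexed by \<open>R\<close> span the same space, a
  coordinate subspace of dimension \<open>card R\<close>.\<close>

lemma rank_monomial: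
  assumes A: "A \<in> carrier_mat n nc"
    and col: "\<And>j. j < nc \<Longrightarrow> \<exists>i c. i \<in> R \<and> col A j = c \<cdot>\<^sub>v unit_vec n i \<or> col A j = 0\<^sub>v n"
    and R: "R \<subseteq> {..<n}"
    and unit: "\<And>i. i \<in> R \<Longrightarrow> \<exists>j<nc. \<exists>c. c \<noteq> 0 \<and> col A j = c \<cdot>\<^sub>v unit_vec n i"
  shows "rank A = card R"
proof -
  have cols: "set (cols A) = col A ` {..<nc}"
    using A by (auto simp: cols_def)
  have carr: "set (cols A) \<subseteq> carrier_vec n" using A cols_dim by blast
  have "span (set (cols A)) = span (unit_vec n ` R)"
  proof
    have "col A j \<in> span (unit_vec n ` R)" if "j < nc" for j
      unfolding span_unit_vecs_subset[OF R]
      using col[OF that] R by (auto simp: subset_iff)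
    then show "span (set (cols A)) \<subseteq> span (unit_vec n ` R)"
      by (intro span_subsetI) (auto simp: cols)
    have "unit_vec n i \<in> span (set (cols A))" if i: "i \<in> R" for i
    proof -
      obtain j c where jc: "j < nc" "c \<noteq> 0" "col A j = c \<cdot>\<^sub>v unit_vec n i"
        using unit[OF i] by blast
      have "unit_vec n i = inverse c \<cdot>\<^sub>v col A j"
        using jc by (simp add: smult_smult_assoc)
      moreover have "inverse c \<cdot>\<^sub>v col A j \<in> span (set (cols A))"
        using jc(1) carr unfolding cols by (intro smult_in_span span_mem imageI) auto
      ultimately show ?thesis by simp
    qed
    then show "span (unit_vec n ` R) \<subseteq> span (set (cols A))"
      by (intro span_subsetI[OF carr]) auto
  qed
  then show ?thesis
    unfolding rank_def span_unit_vecs_subset[OF R] using dim_zero_coords[OF R] by simp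
qed

lemma row_space_zero_coords:
  assumes A: "A \<in> carrier_mat m n" and "\<And>i j. i < m \<Longrightarrow> j < n \<Longrightarrow> j \<notin> R \<Longrightarrow> A $$ (i, j) = 0"
  shows "row_space A \<subseteq> {v \<in> carrier_vec n. \<forall>j<n. j \<notin> R \<longrightarrow> v $ j = 0}"
  unfolding row_space_def
  using assms by (intro span_is_subset[OF _ zero_coords_submodule]) (auto simp: rows_def)

lemma row_in_row_space:
  assumes A: "A \<in> carrier_mat m n" and "i < m"
  shows "row A i \<in> row_space A"
  unfolding row_space_def using assms by (intro span_mem) (auto simp: rows_def)

end

section \<open>Determinants of sparse matrices\<close>

lemma det_zero_row:
  assumes A: "A \<in> carrier_mat n n" and "i < n" and "\<And>j. j < n \<Longrightarrow> A $$ (i, j) = 0"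
  shows "det A = 0"
  unfolding det_def'[OF A]
proof (intro sum.neutral ballI)
  fix p assume "p \<in> {p. p permutes {0..<n}}"
  then have "p i < n" using assms(2) permutes_in_image[of p "{0..<n}" i] by simp
  then have "(\<Prod>i = 0..<n. A $$ (i, p i)) = 0"
    using assms(2,3) by (intro prod_zero bexI[of _ i]) auto
  then show "signof p * (\<Prod>i = 0..<n. A $$ (i, p i)) = 0" by simp
qed

lemma det_zero_col:
  assumes A: "A \<in> carrier_mat n n" and "j < n" and "\<And>i. i < n \<Longrightarrow> A $$ (i, j) = 0"
  shows "det A = 0"
proof -
  have "det (transpose_mat A) = 0"
    using assms by (intro det_zero_row[of _ n j]) auto
  then show ?thesis using det_transpose[OF A] by simp
qed

text \<open>In the Leibniz expansion any permutation other than \<open>\<pi>\<close> differs from it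
  at some row below \<open>n\<close> and picks a zero there.\<close>

lemma det_generalized_permutation:
  assumes A: "A \<in> carrier_mat n n" and \<pi>: "\<pi> permutes {0..<n}"
    and entry: "\<And>i j. i < n \<Longrightarrow> j < n \<Longrightarrow> A $$ (i, j) = (if j = \<pi> i then c i else 0)"
  shows "det A = signof \<pi> * (\<Prod>i = 0..<n. c i)"
proof -
  have ran: "p i < n" if "p permutes {0..<n}" "i < n" for p i
    using that permutes_in_image[of p "{0..<n}" i] by simp
  have "(\<Sum>p | p permutes {0..<n}. signof p * (\<Prod>i = 0..<n. A $$ (i, p i))) =
      (\<Sum>p\<in>{\<pi>}. signof p * (\<Prod>i = 0..<n. A $$ (i, p i)))"
  proof (rule sum.mono_neutral_right)
    show "\<forall>p\<in>{p. p permutes {0..<n}} - {\<pi>}. signof p * (\<Prod>i = 0..<n. A $$ (i, p i)) = 0"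
    proof
      fix p assume p: "p \<in> {p. p permutes {0..<n}} - {\<pi>}"
      then obtain i where i: "p i \<noteq> \<pi> i" by auto
      then have "i < n"
        using p \<pi> permutes_not_in[of p "{0..<n}" i] permutes_not_in[of \<pi> "{0..<n}" i] by force
      then have "(\<Prod>i = 0..<n. A $$ (i, p i)) = 0"
        using entry[of i "p i"] ran[of p i] p i by (intro prod_zero bexI[of _ i]) auto
      then show "signof p * (\<Prod>i = 0..<n. A $$ (i, p i)) = 0" by simp
    qed
  qed (use \<pi> finite_permutations in auto)
  also have "\<dots> = signof \<pi> * (\<Prod>i = 0..<n. c i)"
    using entry ran[OF \<pi>] by simp
  finally show ?thesis unfolding det_def'[OF A] .
qed


section \<open>Local coordinates at a coordinate point\<close>

lemma ksubsetsD:
  assumes "I \<in> ksubsets n k"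
  shows "finite I" "I \<subseteq> {1..n}" "card I = k" "length (sorted_list_of_set I) = k"
  using assms by (auto simp: ksubsets_def intro: finite_subset)

lemma sorted_list_of_set_bij_betw:
  assumes "finite I" "card I = k"
  shows "bij_betw ((!) (sorted_list_of_set I)) {0..<k} I"
  using assms bij_betw_nth[of "sorted_list_of_set I" "{0..<k}" I] by (simp add: atLeast0LessThan)

lemma sorted_list_of_set_nth_mem:
  assumes "I \<in> ksubsets n k" "c < k"
  shows "sorted_list_of_set I ! c \<in> I"
  using nth_mem[of c "sorted_list_of_set I"] ksubsetsD[OF assms(1)] assms(2) by simp

lemma bij_betw_Collect:
  "bij_betw f A T \<Longrightarrow> bij_betw f {a \<in> A. P (f a)} {t \<in> T. P t}"
  by (auto simp: bij_betw_def inj_on_def)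

lemma set_coord_list: "set (coord_list k n B) = {1..k} \<times> ({1..n} - B)"
  by (auto simp: coord_list_def)

lemma distinct_coord_list: "distinct (coord_list k n B)"
  by (simp add: coord_list_def distinct_product)

lemma length_coord_list:
  assumes "B \<in> ksubsets n k"
  shows "length (coord_list k n B) = k * (n - k)"
proof -
  have "length (coord_list k n B) = card ({1..k} \<times> ({1..n} - B))"
    using distinct_card[OF distinct_coord_list] set_coord_list by metis
  also have "\<dots> = k * (n - k)"
    using ksubsetsD[OF assms] by (simp add: card_cartesian_product card_Diff_subset)
  finally show ?thesis .
qed

lemma set_nonbasis_list: "set (nonbasis_list k n M) = ksubsets n k - M"
proof -
  have "set (map set (subseqs [1..<n+1])) = Pow {1..n}"
    using subseqs_powset[of "[1..<n+1]"] by (auto simp: atLeastLessThanSuc_atLeastAtMost)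
  then show ?thesis by (auto simp: nonbasis_list_def ksubsets_def)
qed

lemma distinct_nonbasis_list: "distinct (nonbasis_list k n M)"
  unfolding nonbasis_list_def by (intro distinct_filter distinct_set_subseqs) simp

text \<open>The only chart containing the coordinate point of \<open>J\<close> is the one of
  \<open>J\<close> itself, with the point at its origin. Vectors in the row space vanish outside
  \<open>J\<close>, so the chart matrix has zero columns there. The columns in \<open>B\<close>
  contain a 1, hence \<open>B\<close> is contained in \<open>J\<close>; the remaining columns hold
  the coordinates.\<close>

lemma chart_eq_coordinate_point:
  assumes B: "B \<in> ksubsets n k" and J: "J \<in> ksubsets n k"
    and eq: "chart k n B x = coordinate_point k n J"
  shows "B = J" and "\<And>p. p \<in> set (coord_list k n B) \<Longrightarrow> x p = 0"
proof -
  let ?A = "chart_mat k n B x"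
  have A: "?A \<in> carrier_mat k n" by (simp add: chart_mat_def)
  note bij = sorted_list_of_set_bij_betw[OF ksubsetsD(1,3)]
  have "sorted_list_of_set J ! i \<noteq> j + 1" if "i < k" "j + 1 \<notin> J" for i j
    using sorted_list_of_set_nth_mem[OF J that(1)] that(2) by metis
  then have "coordinate_point k n J \<subseteq>
      {v \<in> carrier_vec n. \<forall>j<n. j \<notin> {j. j + 1 \<in> J} \<longrightarrow> v $ j = 0}"
    unfolding coordinate_point_def
    by (intro vec_space.row_space_zero_coords[where m = k]) auto
  then have zero: "?A $$ (i, j) = 0" if "i < k" "j < n" "j + 1 \<notin> J" for i j
    using vec_space.row_in_row_space[OF A that(1)] that A unfolding eq[symmetric] chart_def
    by (auto simp: subset_iff)
  have "B \<subseteq> J"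
  proof
    fix b assume b: "b \<in> B"
    then obtain i where i: "i < k" "sorted_list_of_set B ! i = b"
      using bij[OF B B] unfolding bij_betw_def by (metis atLeastLessThan_iff imageE)
    have "b \<in> {1..n}" using b ksubsetsD[OF B] by auto
    then have "b - 1 < n" "b - 1 + 1 = b" by auto
    then show "b \<in> J"
      using zero[of i "b - 1"] i b by (auto simp: chart_mat_def)
  qed
  then show BJ: "B = J"
    using ksubsetsD[OF B] ksubsetsD[OF J] by (intro card_subset_eq) auto
  show "x p = 0" if p: "p \<in> set (coord_list k n B)" for p
  proof -
    obtain a b where ab: "p = (a, b)" "a \<in> {1..k}" "b \<in> {1..n}" "b \<notin> B"
      using p by (auto simp: set_coord_list)
    then have "a - 1 < k" "a - 1 + 1 = a" "b - 1 < n" "b - 1 + 1 = b" by auto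
    then show ?thesis
      using zero[of "a - 1" "b - 1"] BJ ab by (auto simp: chart_mat_def)
  qed
qed

section \<open>Coordinates as single exchanges\<close>

text \<open>As in the charts, \<open>a\<close> is a row index counted from 1 and \<open>b\<close> is a column outside \<open>B\<close>.\<close>

definition exchange :: "nat set \<Rightarrow> nat \<times> nat \<Rightarrow> nat set" where
  "exchange B = (\<lambda>(a, b). insert b (B - {sorted_list_of_set B ! (a - 1)}))"

text \<open>The element \<open>b\<close> is recovered as the only one of
  \<open>exchange B (a, b)\<close> outside \<open>B\<close>, and row \<open>a\<close> from the only
  element of \<open>B\<close> that is lost. The subtraction is in the integers so that the right
  side is empty for \<open>k = 0\<close>, like the set of coordinates; truncated subtraction would
  admit the empty set.\<close>

lemma exchange_bij_betw:
  assumes B: "B \<in> ksubsets n k"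
  shows "bij_betw (exchange B) (set (coord_list k n B))
    {I \<in> ksubsets n k. int (card (I \<inter> B)) = int k - 1}"
  unfolding bij_betw_def
proof
  let ?s = "(!) (sorted_list_of_set B)"
  note D = ksubsetsD[OF B]
  have bij: "bij_betw ?s {0..<k} B" by (rule sorted_list_of_set_bij_betw[OF D(1,3)])
  have mem: "?s (a - 1) \<in> B" if "a \<in> {1..k}" for a
    using bij_betwE[OF bij] that by auto
  show "inj_on (exchange B) (set (coord_list k n B))"
  proof (rule inj_onI)
    fix p q assume pq: "p \<in> set (coord_list k n B)" "q \<in> set (coord_list k n B)"
      and eq: "exchange B p = exchange B q"
    obtain a b a' b' where ab: "p = (a, b)" "q = (a', b')" by fastforce
    have in_range: "a \<in> {1..k}" "a' \<in> {1..k}" "b \<notin> B" "b' \<notin> B"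
      using pq by (auto simp: ab set_coord_list)
    have "exchange B p - B = {b}" "exchange B q - B = {b'}"
      "B - exchange B p = {?s (a - 1)}" "B - exchange B q = {?s (a' - 1)}"
      using in_range mem by (auto simp: ab exchange_def)
    then have "b = b'" "?s (a - 1) = ?s (a' - 1)" using eq by auto
    moreover from this have "a - 1 = a' - 1"
      using bij in_range by (auto simp: bij_betw_def inj_on_def)
    ultimately show "p = q" using in_range ab by auto
  qed
  show "exchange B ` set (coord_list k n B) = {I \<in> ksubsets n k. int (card (I \<inter> B)) = int k - 1}"
  proof
    show "exchange B ` set (coord_list k n B) \<subseteq> {I \<in> ksubsets n k. int (card (I \<inter> B)) = int k - 1}"
    proof (rule image_subsetI)
      fix p assume "p \<in> set (coord_list k n B)"
      then obtain a b where ab: "p = (a, b)" "a \<in> {1..k}" "b \<in> {1..n}" "b \<notin> B"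
        by (auto simp: set_coord_list)
      have "exchange B p \<inter> B = B - {?s (a - 1)}"
        using ab by (auto simp: exchange_def)
      moreover have "card (B - {?s (a - 1)}) = k - 1"
        using mem[OF ab(2)] D by simp
      moreover have "card (exchange B p) = Suc (card (B - {?s (a - 1)}))"
        using ab D by (simp add: exchange_def)
      ultimately show "exchange B p \<in> {I \<in> ksubsets n k. int (card (I \<inter> B)) = int k - 1}"
        using ab D by (auto simp: ksubsets_def exchange_def)
    qed
    show "{I \<in> ksubsets n k. int (card (I \<inter> B)) = int k - 1} \<subseteq> exchange B ` set (coord_list k n B)"
    proof
      fix I assume I: "I \<in> {I \<in> ksubsets n k. int (card (I \<inter> B)) = int k - 1}"
      then have Ik: "I \<in> ksubsets n k" and c: "card (I \<inter> B) + 1 = k" by auto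
      note DI = ksubsetsD[OF Ik]
      have "card (I - B) = 1" "card (B - I) = 1"
        using c D DI card_Diff_subset_Int[of I B] card_Diff_subset_Int[of B I]
        by (auto simp: Int_commute)
      then obtain b b' where b: "I - B = {b}" "B - I = {b'}"
        by (auto simp: card_1_singleton_iff)
      then have "b' \<in> B" by auto
      then obtain i where i: "i < k" "?s i = b'"
        using bij unfolding bij_betw_def by (metis atLeastLessThan_iff imageE)
      have "I = exchange B (i + 1, b)" using b i by (auto simp: exchange_def)
      moreover have "(i + 1, b) \<in> set (coord_list k n B)"
        using b i DI by (auto simp: set_coord_list)
      ultimately show "I \<in> exchange B ` set (coord_list k n B)" by blast
    qed
  qed
qed

section \<open>Minors along coordinate lines through the origin of the chart\<close>

context
  fixes n k :: nat and B :: "nat set" and x :: coords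
  assumes B: "B \<in> ksubsets n k" and x0: "\<And>p. p \<in> set (coord_list k n B) \<Longrightarrow> x p = 0"
begin

lemma chart_mat_line_entry:
  assumes "i < k" "j \<in> {1..n}"
  shows "chart_mat k n B (x(p := t)) $$ (i, j - 1) =
    (if j \<in> B then if sorted_list_of_set B ! i = j then 1 else 0 else if p = (i + 1, j) then t else 0)"
proof -
  have "x (i + 1, j) = 0" if "j \<notin> B"
    using x0[of "(i + 1, j)"] that assms by (auto simp: set_coord_list)
  moreover have "j - 1 < n" "Suc (j - 1) = j" using assms(2) by auto
  ultimately show ?thesis using assms(1) by (auto simp: chart_mat_def)
qed

lemma minor_line_entry:
  assumes I: "I \<in> ksubsets n k" and "i < k" "c < k"
  defines "j \<equiv> sorted_list_of_set I ! c"
  shows "mat k k (\<lambda>(a, b). chart_mat k n B (x(p := t)) $$ (a, sorted_list_of_set I ! b - 1)) $$ (i, c) =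
    (if j \<in> B then if sorted_list_of_set B ! i = j then 1 else 0 else if p = (i + 1, j) then t else 0)"
proof -
  have "j \<in> {1..n}"
    using sorted_list_of_set_nth_mem[OF I assms(3)] ksubsetsD(2)[OF I] unfolding j_def by blast
  then show ?thesis
    using chart_mat_line_entry[of i j p t] assms(2,3) by (simp add: j_def)
qed

text \<open>An element of \<open>I\<close> outside \<open>B\<close> other than \<open>b\<close>
  gives a zero column. Otherwise \<open>I\<close> replaces some \<open>b'\<close> in
  \<open>B\<close> by \<open>b\<close>, and \<open>b'\<close> belongs to a row other than that of
  \<open>p\<close>. That row has its only 1 in column \<open>b'\<close>, outside \<open>I\<close>,
  and misses the entry \<open>t\<close>, so it is zero.\<close>

lemma local_plucker_line_zero:
  assumes p: "p \<in> set (coord_list k n B)" and I: "I \<in> ksubsets n k"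
    and "I \<noteq> B" and "I \<noteq> exchange B p"
  shows "local_plucker k n B I (x(p := t)) = 0"
proof -
  obtain a b where ab: "p = (a, b)" "a \<in> {1..k}" "b \<in> {1..n}" "b \<notin> B"
    using p by (auto simp: set_coord_list)
  note D = ksubsetsD[OF B] and DI = ksubsetsD[OF I]
  note bij = sorted_list_of_set_bij_betw[OF ksubsetsD(1,3)]
  let ?N = "mat k k (\<lambda>(a, b). chart_mat k n B (x(p := t)) $$ (a, sorted_list_of_set I ! b - 1))"
  have "det ?N = 0"
  proof (cases "\<exists>j\<in>I - B. j \<noteq> b")
    case True
    then obtain j where j: "j \<in> I" "j \<notin> B" "j \<noteq> b" by blast
    then obtain c where c: "c < k" "sorted_list_of_set I ! c = j"
      using bij[OF I I] unfolding bij_betw_def by (metis atLeastLessThan_iff imageE)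
    show ?thesis
      using minor_line_entry[OF I _ c(1), of _ p t] c(2) j ab
      by (intro det_zero_col[OF _ c(1)]) auto
  next
    case False
    have "\<not> I \<subseteq> B" using card_subset_eq[of B I] D DI \<open>I \<noteq> B\<close> by auto
    with False have Ib: "I - B = {b}" by auto
    then have "card (I \<inter> B) + 1 = k"
      using card_Diff_subset_Int[of I B] D DI card_mono[of I "I \<inter> B"] by auto
    then have "card (B - I) = 1"
      using card_Diff_subset_Int[of B I] D DI by (auto simp: Int_commute)
    then obtain b' where b': "B - I = {b'}" by (auto simp: card_1_singleton_iff)
    then have "b' \<in> B" by auto
    then obtain i where i: "i < k" "sorted_list_of_set B ! i = b'"
      using bij[OF B B] unfolding bij_betw_def by (metis atLeastLessThan_iff imageE)
    have "i + 1 \<noteq> a"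
    proof
      assume "i + 1 = a"
      then have "exchange B p = insert b (B - {b'})" using i ab by (auto simp: exchange_def)
      also have "\<dots> = I" using b' Ib by auto
      finally show False using \<open>I \<noteq> exchange B p\<close> by simp
    qed
    moreover have "b' \<noteq> sorted_list_of_set I ! c" if "c < k" for c
      using sorted_list_of_set_nth_mem[OF I that] b' by auto
    ultimately have "?N $$ (i, c) = 0" if "c < k" for c
      using minor_line_entry[OF I i(1) that, of p t] i(2) ab that by simp
    then show ?thesis by (intro det_zero_row[OF _ i(1)]) auto
  qed
  then show ?thesis by (simp add: local_plucker_def plucker_def)
qed

lemma local_plucker_line_exchange:
  assumes p: "p \<in> set (coord_list k n B)"
  obtains c where "c \<noteq> 0" "\<And>t. local_plucker k n B (exchange B p) (x(p := t)) = c * t"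
proof -
  obtain a b where ab: "p = (a, b)" "a \<in> {1..k}" "b \<in> {1..n}" "b \<notin> B"
    using p by (auto simp: set_coord_list)
  let ?I = "exchange B p"
  have I: "?I \<in> ksubsets n k"
    using bij_betwE[OF exchange_bij_betw[OF B]] p by blast
  note bij = sorted_list_of_set_bij_betw[OF ksubsetsD(1,3)]
  let ?sB = "(!) (sorted_list_of_set B)" and ?sI = "(!) (sorted_list_of_set ?I)"
  \<comment> \<open>The column holding the only possibly nonzero entry of row \<open>i\<close>: the
    old 1, or \<open>t\<close> in the row of \<open>p\<close>.\<close>
  define \<tau> where "\<tau> = (\<lambda>i. if i + 1 = a then b else ?sB i)"
  have memB: "?sB i \<in> B" if "i < k" for i using bij_betwE[OF bij[OF B B]] that by auto
  have injB: "?sB i = ?sB j \<longleftrightarrow> i = j" if "i < k" "j < k" for i j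
    using bij[OF B B] that by (auto simp: bij_betw_def inj_on_def)
  have "inj_on \<tau> {0..<k}"
    using memB injB ab(4) by (auto simp: inj_on_def \<tau>_def)
  moreover have "\<tau> ` {0..<k} \<subseteq> ?I"
  proof (rule image_subsetI)
    fix i assume "i \<in> {0..<k}"
    then show "\<tau> i \<in> ?I"
      using memB[of i] injB[of i "a - 1"] ab by (auto simp: \<tau>_def exchange_def)
  qed
  ultimately have \<tau>: "bij_betw \<tau> {0..<k} ?I"
    using ksubsetsD[OF I] by (intro bij_betw_imageI card_subset_eq) (auto simp: card_image)
  \<comment> \<open>The minor orders its columns by the sorted list of the new set, so
    \<open>\<tau>\<close> is converted to positions in that list. The resulting sign is the nonzero
    constant sought.\<close>
  define \<pi> where "\<pi> = (\<lambda>i. if i < k then inv_into {0..<k} ?sI (\<tau> i) else i)"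
  have "bij_betw (inv_into {0..<k} ?sI \<circ> \<tau>) {0..<k} {0..<k}"
    by (rule bij_betw_trans[OF \<tau> bij_betw_inv_into[OF bij[OF I I]]])
  then have "bij_betw \<pi> {0..<k} {0..<k}"
    by (rule bij_betw_cong[THEN iffD1, rotated]) (simp add: \<pi>_def)
  then have \<pi>: "\<pi> permutes {0..<k}"
    by (rule bij_imp_permutes) (simp add: \<pi>_def)
  have \<pi>_iff: "c = \<pi> i \<longleftrightarrow> ?sI c = \<tau> i" if "i < k" "c < k" for i c
  proof -
    have "\<tau> i \<in> ?sI ` {0..<k}"
      using bij[OF I I] \<tau> that(1) by (auto simp: bij_betw_def)
    then have "?sI (\<pi> i) = \<tau> i" "\<pi> i \<in> {0..<k}"
      using that(1) f_inv_into_f[of "\<tau> i" ?sI "{0..<k}"] inv_into_into[of "\<tau> i" ?sI "{0..<k}"]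
      by (auto simp: \<pi>_def)
    then show ?thesis
      using bij[OF I I] that(2) by (auto simp: bij_betw_def inj_on_def)
  qed
  show ?thesis
  proof
    show "signof \<pi> \<noteq> (0 :: complex)" by (simp add: sign_def)
    fix t
    let ?N = "mat k k (\<lambda>(a, b). chart_mat k n B (x(p := t)) $$ (a, sorted_list_of_set ?I ! b - 1))"
    have "det ?N = signof \<pi> * (\<Prod>i = 0..<k. if i = a - 1 then t else 1)"
    proof (rule det_generalized_permutation[OF _ \<pi>])
      fix i c assume ic: "i < k" "c < k"
      have "?sI c \<in> ?I" using bij_betwE[OF bij[OF I I]] ic by auto
      then have "?sI c = b \<or> ?sI c \<in> B \<and> ?sI c \<noteq> ?sB (a - 1)"
        using ab by (auto simp: exchange_def)
      then show "?N $$ (i, c) = (if c = \<pi> i then if i = a - 1 then t else 1 else 0)"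
        unfolding minor_line_entry[OF I ic] \<pi>_iff[OF ic]
        using ab memB[OF ic(1)] by (auto simp: \<tau>_def)
    qed simp
    also have "(\<Prod>i = 0..<k. if i = a - 1 then t else 1) = t"
      using ab by (subst prod.delta) auto
    finally show "local_plucker k n B ?I (x(p := t)) = signof \<pi> * t"
      unfolding local_plucker_def plucker_def .
  qed
qed

lemma partial_deriv_local_plucker:
  assumes p: "p \<in> set (coord_list k n B)" and I: "I \<in> ksubsets n k" "I \<noteq> B"
  shows "partial_deriv (local_plucker k n B I) p x = 0 \<longleftrightarrow> I \<noteq> exchange B p"
proof (cases "I = exchange B p")
  case True
  obtain c where c: "c \<noteq> 0" "\<And>t. local_plucker k n B (exchange B p) (x(p := t)) = c * t"
    using local_plucker_line_exchange[OF p] by blast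
  then show ?thesis using True by (simp add: partial_deriv_def)
next
  case False
  then show ?thesis
    using local_plucker_line_zero[OF p I] by (simp add: partial_deriv_def)
qed

section \<open>Tangent space and rank of the Jacobian matrix\<close>

context
  fixes M :: "nat set set"
  assumes BM: "B \<in> M"
begin

text \<open>The generator belonging to an exchange outside \<open>M\<close> has just one nonzero
  partial derivative, which kills that entry of \<open>t\<close>. Conversely, along the line of an
  exchange inside \<open>M\<close> all generators vanish identically, since \<open>B\<close> is in
  \<open>M\<close> too. So every member of the ideal vanishes there, whatever its coefficients, and
  no product rule is needed.\<close>

lemma tangent_space_eq:
  "tangent_space k n M B x = {t \<in> carrier_vec (length (coord_list k n B)).
     \<forall>j<length (coord_list k n B). j \<notin> {j. j < length (coord_list k n B) \<and>
       exchange B (coord_list k n B ! j) \<in> M} \<longrightarrow> t $ j = 0}"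
    (is "_ = ?T")
proof
  let ?cl = "coord_list k n B"
  have exch: "exchange B (?cl ! j) \<in> ksubsets n k" if "j < length ?cl" for j
    using bij_betwE[OF exchange_bij_betw[OF B]] nth_mem[OF that] by blast
  have fin: "finite (ksubsets n k)"
    by (rule finite_subset[of _ "Pow {1..n}"]) (auto simp: ksubsets_def)
  show "tangent_space k n M B x \<subseteq> ?T"
  proof
    fix t assume t: "t \<in> tangent_space k n M B x"
    have "t $ j = 0" if j: "j < length ?cl" and notin: "exchange B (?cl ! j) \<notin> M" for j
    proof -
      let ?I = "exchange B (?cl ! j)"
      \<comment> \<open>These constant coefficients exhibit a single generator as a member of the
        ideal.\<close>
      let ?g = "\<lambda>I (_ :: coords). if I = ?I then 1 else (0 :: complex)"
      have I: "?I \<in> ksubsets n k - M" using exch[OF j] notin by simp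
      then have IB: "?I \<in> ksubsets n k" "?I \<noteq> B" using BM by auto
      have "local_plucker k n B ?I = (\<lambda>x. \<Sum>I\<in>ksubsets n k - M. ?g I x * local_plucker k n B I x)"
      proof
        fix z
        have "(\<Sum>I\<in>ksubsets n k - M. ?g I z * local_plucker k n B I z) =
            (\<Sum>I\<in>ksubsets n k - M. if I = ?I then local_plucker k n B I z else 0)"
          by (rule sum.cong) auto
        also have "\<dots> = local_plucker k n B ?I z" using I fin by simp
        finally show "local_plucker k n B ?I z = (\<Sum>I\<in>ksubsets n k - M. ?g I z * local_plucker k n B I z)"
          by simp
      qed
      then have "local_plucker k n B ?I \<in> positroid_ideal k n M B"
        unfolding positroid_ideal_def mem_Collect_eq
        by (intro exI[of _ ?g] conjI ballI poly_functions.const)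
      then have "(\<Sum>i<length ?cl. partial_deriv (local_plucker k n B ?I) (?cl ! i) x * t $ i) = 0"
        using t by (simp add: tangent_space_def)
      moreover have "(\<Sum>i<length ?cl. partial_deriv (local_plucker k n B ?I) (?cl ! i) x * t $ i) =
          (\<Sum>i<length ?cl. if i = j then partial_deriv (local_plucker k n B ?I) (?cl ! j) x * t $ j else 0)"
      proof (rule sum.cong)
        fix i assume "i \<in> {..<length ?cl}"
        then have i: "i < length ?cl" by simp
        have "?I \<noteq> exchange B (?cl ! i)" if "i \<noteq> j"
          using inj_on_eq_iff[OF bij_betw_imp_inj_on[OF exchange_bij_betw[OF B]] nth_mem[OF j] nth_mem[OF i]]
            nth_eq_iff_index_eq[OF distinct_coord_list j i] that by simp
        then show "partial_deriv (local_plucker k n B ?I) (?cl ! i) x * t $ i =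
            (if i = j then partial_deriv (local_plucker k n B ?I) (?cl ! j) x * t $ j else 0)"
          using partial_deriv_local_plucker[OF nth_mem[OF i] IB] by (cases "i = j") auto
      qed simp
      ultimately have "partial_deriv (local_plucker k n B ?I) (?cl ! j) x * t $ j = 0"
        using j by simp
      moreover have "partial_deriv (local_plucker k n B ?I) (?cl ! j) x \<noteq> 0"
        using partial_deriv_local_plucker[OF nth_mem[OF j] IB] by simp
      ultimately show ?thesis by simp
    qed
    then show "t \<in> ?T" using t by (auto simp: tangent_space_def)
  qed
  show "?T \<subseteq> tangent_space k n M B x"
  proof
    fix t assume t: "t \<in> ?T"
    have "(\<Sum>j<length ?cl. partial_deriv f (?cl ! j) x * t $ j) = 0"
      if f: "f \<in> positroid_ideal k n M B" for f
    proof (intro sum.neutral ballI)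
      fix j assume "j \<in> {..<length ?cl}"
      then have j: "j < length ?cl" by simp
      obtain g where g: "f = (\<lambda>x. \<Sum>I\<in>ksubsets n k - M. g I x * local_plucker k n B I x)"
        using f by (auto simp: positroid_ideal_def)
      show "partial_deriv f (?cl ! j) x * t $ j = 0"
      proof (cases "exchange B (?cl ! j) \<in> M")
        case True
        have "local_plucker k n B I (x(?cl ! j := s)) = 0" if "I \<in> ksubsets n k - M" for I s
          using that True BM by (intro local_plucker_line_zero[OF nth_mem[OF j]]) auto
        then have "f (x(?cl ! j := s)) = 0" for s by (simp add: g)
        then show ?thesis by (simp add: partial_deriv_def)
      next
        case False
        then show ?thesis using t j by simp
      qed
    qed
    then show "t \<in> tangent_space k n M B x" using t by (simp add: tangent_space_def)
  qed
qed

lemma exchange_nonbasis_bij_betw: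
  "bij_betw (\<lambda>j. exchange B (coord_list k n B ! j))
     {j. j < length (coord_list k n B) \<and> exchange B (coord_list k n B ! j) \<notin> M}
     {I \<in> ksubsets n k - M. int (card (I \<inter> B)) = int k - 1}"
proof -
  let ?cl = "coord_list k n B"
  have "bij_betw ((!) ?cl) {..<length ?cl} (set ?cl)"
    by (rule bij_betw_nth[OF distinct_coord_list]) auto
  from bij_betw_trans[OF this exchange_bij_betw[OF B]]
  have bij: "bij_betw (\<lambda>j. exchange B (?cl ! j)) {..<length ?cl}
      {I \<in> ksubsets n k. int (card (I \<inter> B)) = int k - 1}" by (simp add: comp_def)
  have "{I \<in> {I \<in> ksubsets n k. int (card (I \<inter> B)) = int k - 1}. I \<notin> M} =
      {I \<in> ksubsets n k - M. int (card (I \<inter> B)) = int k - 1}" by auto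
  then show ?thesis
    using bij_betw_Collect[OF bij, of "\<lambda>I. I \<notin> M"] by simp
qed

text \<open>The Grassmannian has as many local coordinates as its dimension, and the tangent space
  uses those with exchange in \<open>M\<close>. The codimension counts the others.\<close>

lemma tangent_codim_eq:
  "tangent_codim k n M B x = card {I \<in> ksubsets n k - M. int (card (I \<inter> B)) = int k - 1}"
proof -
  let ?cl = "coord_list k n B"
  let ?S = "{j. j < length ?cl \<and> exchange B (?cl ! j) \<in> M}"
  let ?S' = "{j. j < length ?cl \<and> exchange B (?cl ! j) \<notin> M}"
  have "tangent_codim k n M B x = length ?cl - card ?S"
    unfolding tangent_codim_def tangent_space_eq length_coord_list[OF B, symmetric]
    by (subst vec_space.dim_zero_coords) auto
  also have "\<dots> = card ?S'"
  proof -
    have "card ?S + card ?S' = card (?S \<union> ?S')"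
      by (rule card_Un_disjoint[symmetric]) auto
    also have "?S \<union> ?S' = {..<length ?cl}" by auto
    finally show ?thesis by simp
  qed
  also have "\<dots> = card {I \<in> ksubsets n k - M. int (card (I \<inter> B)) = int k - 1}"
    by (rule bij_betw_same_card[OF exchange_nonbasis_bij_betw])
  finally show ?thesis .
qed

text \<open>A column whose exchange lies in \<open>M\<close> is zero; any other has its only nonzero
  entry in the row of its exchange. The rows reached in this way are those in
  \<open>R\<close>.\<close>

lemma rank_jacobian_eq:
  "mat_rank (jacobian k n M B x) = card {I \<in> ksubsets n k - M. int (card (I \<inter> B)) = int k - 1}"
proof -
  let ?cl = "coord_list k n B" and ?nl = "nonbasis_list k n M"
  let ?A = "jacobian k n M B x"
  define R where "R = {i. i < length ?nl \<and> int (card (?nl ! i \<inter> B)) = int k - 1}"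
  have A: "?A \<in> carrier_mat (length ?nl) (length ?cl)" by (simp add: jacobian_def)
  have nl: "?nl ! i \<in> ksubsets n k - M" if "i < length ?nl" for i
    using nth_mem[OF that] by (simp add: set_nonbasis_list)
  have entry: "?A $$ (i, j) = 0 \<longleftrightarrow> ?nl ! i \<noteq> exchange B (?cl ! j)"
    if "i < length ?nl" "j < length ?cl" for i j
    using partial_deriv_local_plucker[OF nth_mem[OF that(2)], of "?nl ! i"] nl[OF that(1)] BM that
    by (auto simp: jacobian_def)
  have col: "col ?A j = ?A $$ (i, j) \<cdot>\<^sub>v unit_vec (length ?nl) i"
    if i: "i < length ?nl" and j: "j < length ?cl" and "?nl ! i = exchange B (?cl ! j)" for i j
  proof (rule eq_vecI)
    fix i' assume "i' < dim_vec (?A $$ (i, j) \<cdot>\<^sub>v unit_vec (length ?nl) i)"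
    then have i': "i' < length ?nl" by simp
    then have "?A $$ (i', j) = 0" if "i' \<noteq> i"
      using entry[OF i' j] \<open>?nl ! i = _\<close> that nth_eq_iff_index_eq[OF distinct_nonbasis_list i i'] by auto
    then show "col ?A j $ i' = (?A $$ (i, j) \<cdot>\<^sub>v unit_vec (length ?nl) i) $ i'"
      using A i i' j by auto
  qed (use A in auto)
  have "vec_space.rank (length ?nl) ?A = card R"
  proof (rule vec_space.rank_monomial[OF A])
    fix j assume j: "j < length ?cl"
    show "\<exists>i c. i \<in> R \<and> col ?A j = c \<cdot>\<^sub>v unit_vec (length ?nl) i \<or> col ?A j = 0\<^sub>v (length ?nl)"
    proof (cases "exchange B (?cl ! j) \<in> M")
      case True
      have "?A $$ (i, j) = 0" if "i < length ?nl" for i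
        using entry[OF that j] nl[OF that] True by auto
      then have "col ?A j = 0\<^sub>v (length ?nl)"
        using A j by (intro eq_vecI) auto
      then show ?thesis by blast
    next
      case False
      then have "exchange B (?cl ! j) \<in> {I \<in> ksubsets n k - M. int (card (I \<inter> B)) = int k - 1}"
        using bij_betwE[OF exchange_nonbasis_bij_betw] j by auto
      moreover from this obtain i where "i < length ?nl" "?nl ! i = exchange B (?cl ! j)"
        using set_nonbasis_list[of k n M] by (metis (no_types, lifting) in_set_conv_nth mem_Collect_eq)
      ultimately show ?thesis using col[of i j] j by (auto simp: R_def)
    qed
  next
    fix i assume i: "i \<in> R"
    then have "?nl ! i \<in> {I \<in> ksubsets n k - M. int (card (I \<inter> B)) = int k - 1}"
      using nl by (simp add: R_def)
    then have "?nl ! i \<in> (\<lambda>j. exchange B (?cl ! j)) ` {j. j < length ?cl \<and> exchange B (?cl ! j) \<notin> M}"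
      using bij_betw_imp_surj_on[OF exchange_nonbasis_bij_betw] by simp
    then obtain j where "j < length ?cl" "?nl ! i = exchange B (?cl ! j)" by auto
    then show "\<exists>j<length ?cl. \<exists>c. c \<noteq> 0 \<and> col ?A j = c \<cdot>\<^sub>v unit_vec (length ?nl) i"
      using col[of i j] entry[of i j] i by (auto simp: R_def)
  qed (auto simp: R_def)
  moreover have "card R = card {I \<in> ksubsets n k - M. int (card (I \<inter> B)) = int k - 1}"
  proof (rule bij_betw_same_card)
    have bij: "bij_betw ((!) ?nl) {..<length ?nl} (ksubsets n k - M)"
      using bij_betw_nth[OF distinct_nonbasis_list] set_nonbasis_list by blast
    show "bij_betw ((!) ?nl) R {I \<in> ksubsets n k - M. int (card (I \<inter> B)) = int k - 1}"
      using bij_betw_Collect[OF bij, of "\<lambda>I. int (card (I \<inter> B)) = int k - 1"] by (simp add: R_def)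
  qed
  ultimately show ?thesis using A by (simp add: mat_rank_def)
qed

end
end

theorem theorem1p5:
  fixes n k :: nat and d :: "(nat \<Rightarrow> nat) \<times> nat set" and u v y :: "nat \<Rightarrow> nat"
    and M :: "nat set set" and B :: "nat set" and x :: coords
  assumes "k \<le> n"
    and "d \<in> decorated_perms n k"
    and "associated_pair n k d u v"
    and "M = positroid n k d"
    and "y \<in> bruhat_interval n u v"
    and "B \<in> ksubsets n k"
    and "chart k n B x = coordinate_point k n (y ` {1..k})"
  shows "tangent_codim k n M B x = mat_rank (jacobian k n M B x) \<and>
    mat_rank (jacobian k n M B x) =
      card {I \<in> ksubsets n k - M. int (card (I \<inter> y ` {1..k})) = int k - 1}"
proof -
  have yM: "y ` {1..k} \<in> M"
    using bruhat_interval_positroid[OF assms(1) _ assms(3,5)] assms(2,4)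
    by (simp add: decorated_perms_def)
  then have "y ` {1..k} \<in> ksubsets n k" using assms(4) by (simp add: positroid_def)
  \<comment> \<open>This identifies \<open>B\<close> with the set \<open>y[k]\<close> and places the
    point at the origin, as the local computations require.\<close>
  note chart = chart_eq_coordinate_point[OF assms(6) this assms(7)]
  have "B \<in> M" using yM chart(1) by simp
  note eqs = tangent_codim_eq[OF assms(6) chart(2) this] rank_jacobian_eq[OF assms(6) chart(2) this]
  show ?thesis using eqs chart(1) by simp
qed

end
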